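(* The linear modified nodal analysis (MNA) model $$A_{\mathrm C}CA_{\mathrm C}^\top\tfrac{\mathrm d}{\mathrm dt}\phi+A_{\mathrm R}GA_{\mathrm R}^\top\phi+A_{\mathrm L}j_{\mathrm L}+A_{\mathrm V}j_{\mathrm V}+A_{\mathrm I}\imath=0,$$ $$L\tfrac{\mathrm d}{\mathrm dt}j_{\mathrm L}-A_{\mathrm L}^\top\phi=0,\qquad A_{\mathrm V}^\top\phi-v=0,$$ with unknowns $\phi\colon[t_0,t_{\mathrm f}]\to\mathbb R^{n_\phi-1}$, $j_{\mathrm L}\colon[t_0,t_{\mathrm f}]\to\mathbb R^{b_{\mathrm L}}$, $j_{\mathrm V}\colon[t_0,t_{\mathrm f}]\to\mathbb R^{b_{\mathrm V}}$ and inputs $\imath\colon[t_0,t_{\mathrm f}]\to\mathbb R^{b_{\mathrm I}}$, $v\colon[t_0,t_{\mathrm f}]\to\mathbb R^{b_{\mathrm V}}$, fits into the structure $$\begin{bmatrix}\nabla_{z_1}\mathcal H(z_1,z_2)\\ \mathcal E\frac{\mathrm d}{\mathrm dt}z_2\\ 0\end{bmatrix}=(\mathcal J-\mathcal R)\begin{bmatrix}\frac{\mathrm d}{\mathrm dt}z_1\\ e(z_1,z_2)\\ z_3\end{bmatrix}+\mathcal B u$$ with $\mathcal J=-\mathcal J^\top$, $\mathcal R=\mathcal R^\top$ positive semi-definite, and $\mathcal E^\top e=\nabla_{z_2}\mathcal H$.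
   Context: "Fits into the structure" means: the unknowns of the model can be grouped into components $z_1,z_2,z_3$ (any of which may be absent) and, with $u$ the vector of inputs of the model (here $u=(\imath,v)$), there exist a function $\mathcal H\in C^1$ of $(z_1,z_2)$, a continuous function $e$ of $(z_1,z_2)$ with values in the space of $z_2$, and real constant matrices $\mathcal E$ (square, possibly singular), $\mathcal J=-\mathcal J^\top$, $\mathcal R=\mathcal R^\top\ge0$, $\mathcal B$ of appropriate sizes, with $\mathcal E^\top e(z_1,z_2)=\nabla_{z_2}\mathcal H(z_1,z_2)$ for all $(z_1,z_2)$, such that the model equations are equivalent to the displayed structured system. In the MNA model, $A_\star\in\mathbb R^{(n_\phi-1)\times b_\star}$, $\star\in\{\mathrm C,\mathrm R,\mathrm L,\mathrm V,\mathrm I\}$, are incidence matrices of the circuit ($n_\phi$ the number of nodes, $b_\star$ the number of branches of the given type), where $A_{\mathrm C}$ need not have full row rank; the capacitance, conductance and inductance matrices $C\in\mathbb R^{b_{\mathrm C}\times b_{\mathrm C}}$, $G\in\mathbb R^{b_{\mathrm R}\times b_{\mathrm R}}$, $L\in\mathbb R^{b_{\mathrm L}\times b_{\mathrm L}}$ are symmetric positive definite. $\phi$ are node potentials, $j_{\mathrm L}$ and $j_{\mathrm V}$ the currents through inductances and voltage sources, $\imath$ and $v$ the source currents and source voltages. *)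

theory Defs
  imports
    "HOL-Analysis.Abstract_Euclidean_Space"
    "HOL-Analysis.Derivative"
    "Jordan_Normal_Form.Matrix"
begin

unbundle no vec_syntax
unbundle no inner_syntax

text \<open>
  Vectors and matrices have explicit dimensions, so that any dimension may be zero
  (absent components, circuits without branches of some type).
\<close>

definition stack :: "real vec list \<Rightarrow> real vec" where
  "stack vs = foldr (@\<^sub>v) vs (0\<^sub>v 0)"

definition positive_semidefinite :: "nat \<Rightarrow> real mat \<Rightarrow> bool" where
  "positive_semidefinite n A \<longleftrightarrow>
     A \<in> carrier_mat n n \<and> A\<^sup>T = A \<and> (\<forall>x \<in> carrier_vec n. x \<bullet> (A *\<^sub>v x) \<ge> 0)"

definition positive_definite :: "nat \<Rightarrow> real mat \<Rightarrow> bool" where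
  "positive_definite n A \<longleftrightarrow>
     A \<in> carrier_mat n n \<and> A\<^sup>T = A \<and>
     (\<forall>x \<in> carrier_vec n. x \<noteq> 0\<^sub>v n \<longrightarrow> x \<bullet> (A *\<^sub>v x) > 0)"


subsection \<open>Calculus on vectors of variable dimension\<close>

text \<open>
  The topological space \<^const>\<open>Euclidean_space\<close> consists of the sequences vanishing from
  index \<open>n\<close> on; \<open>vec n\<close> identifies it with the vectors of dimension \<open>n\<close>.
\<close>

definition continuous_Rn :: "nat \<Rightarrow> (real vec \<Rightarrow> real) \<Rightarrow> bool" where
  "continuous_Rn n f \<longleftrightarrow> continuous_map (Euclidean_space n) euclideanreal (\<lambda>x. f (vec n x))"

definition gradient :: "nat \<Rightarrow> (real vec \<Rightarrow> real) \<Rightarrow> real vec \<Rightarrow> real vec" where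
  "gradient n f x = vec n (\<lambda>i. deriv (\<lambda>s. f (x + s \<cdot>\<^sub>v unit_vec n i)) 0)"

definition C1_Rn :: "nat \<Rightarrow> (real vec \<Rightarrow> real) \<Rightarrow> bool" where
  "C1_Rn n f \<longleftrightarrow>
     (\<forall>i<n. (\<forall>x \<in> carrier_vec n. (\<lambda>s. f (x + s \<cdot>\<^sub>v unit_vec n i)) differentiable (at 0))
          \<and> continuous_Rn n (\<lambda>x. gradient n f x $ i))"

text \<open>A function of a pair of vectors, as a function of the stacked vector.\<close>

definition joint :: "nat \<Rightarrow> nat \<Rightarrow> (real vec \<Rightarrow> real vec \<Rightarrow> 'a) \<Rightarrow> real vec \<Rightarrow> 'a" where
  "joint n1 n2 f w = f (vec_first w n1) (vec_last w n2)"

definition has_time_derivative ::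
    "(real \<Rightarrow> real vec) \<Rightarrow> real vec \<Rightarrow> real \<Rightarrow> real set \<Rightarrow> bool" where
  "has_time_derivative z d t T \<longleftrightarrow>
     dim_vec d = dim_vec (z t) \<and>
     (\<forall>i < dim_vec d. ((\<lambda>s. z s $ i) has_real_derivative d $ i) (at t within T))"


subsection \<open>The structured system\<close>

text \<open>The structured system at time \<open>t\<close>; the derivatives are taken within the time interval \<open>T\<close>.\<close>

definition structured_equations ::
    "real set \<Rightarrow> nat \<Rightarrow> nat \<Rightarrow> (real vec \<Rightarrow> real vec \<Rightarrow> real) \<Rightarrow> (real vec \<Rightarrow> real vec \<Rightarrow> real vec) \<Rightarrow>
     real mat \<Rightarrow> real mat \<Rightarrow> real mat \<Rightarrow> real mat \<Rightarrow>
     (real \<Rightarrow> real vec) \<Rightarrow> (real \<Rightarrow> real vec) \<Rightarrow> (real \<Rightarrow> real vec) \<Rightarrow> (real \<Rightarrow> real vec) \<Rightarrow> real \<Rightarrow> bool"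
  where
  "structured_equations T n1 n3 H e E J R B z1 z2 z3 u t \<longleftrightarrow>
     (\<exists>dz1 dz2. has_time_derivative z1 dz1 t T \<and> has_time_derivative z2 dz2 t T \<and>
        stack [gradient n1 (\<lambda>w. H w (z2 t)) (z1 t), E *\<^sub>v dz2, 0\<^sub>v n3] =
          (J - R) *\<^sub>v stack [dz1, e (z1 t) (z2 t), z3 t] + B *\<^sub>v u t)"

text \<open>
  A model has a list of unknowns \<open>xs\<close> with dimensions \<open>ns\<close> and a list of inputs \<open>us\<close> with
  dimensions \<open>ms\<close>; \<open>M xs us t\<close> states that its equations hold at time \<open>t\<close>. The index lists
  \<open>p1\<close>, \<open>p2\<close>, \<open>p3\<close>, any of which may be empty, distribute the unknowns over the three components.
\<close>

definition fits_into_structure ::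
    "real set \<Rightarrow> nat list \<Rightarrow> nat list \<Rightarrow>
     ((real \<Rightarrow> real vec) list \<Rightarrow> (real \<Rightarrow> real vec) list \<Rightarrow> real \<Rightarrow> bool) \<Rightarrow> bool"
  where
  "fits_into_structure T ns ms M \<longleftrightarrow>
     (\<exists>p1 p2 p3 n1 n2 n3 m H e E J R B.
        distinct (p1 @ p2 @ p3) \<and> set (p1 @ p2 @ p3) = {..<length ns} \<and>
        n1 = (\<Sum>k\<leftarrow>p1. ns ! k) \<and> n2 = (\<Sum>k\<leftarrow>p2. ns ! k) \<and> n3 = (\<Sum>k\<leftarrow>p3. ns ! k) \<and>
        m = sum_list ms \<and>
        C1_Rn (n1 + n2) (joint n1 n2 H) \<and>
        (\<forall>z1 \<in> carrier_vec n1. \<forall>z2 \<in> carrier_vec n2. e z1 z2 \<in> carrier_vec n2) \<and>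
        (\<forall>i<n2. continuous_Rn (n1 + n2) (joint n1 n2 (\<lambda>z1 z2. e z1 z2 $ i))) \<and>
        E \<in> carrier_mat n2 n2 \<and>
        J \<in> carrier_mat (n1 + n2 + n3) (n1 + n2 + n3) \<and> J = - J\<^sup>T \<and>
        positive_semidefinite (n1 + n2 + n3) R \<and>
        B \<in> carrier_mat (n1 + n2 + n3) m \<and>
        (\<forall>z1 \<in> carrier_vec n1. \<forall>z2 \<in> carrier_vec n2.
           E\<^sup>T *\<^sub>v e z1 z2 = gradient n2 (\<lambda>w. H z1 w) z2) \<and>
        (\<forall>xs us.
           length xs = length ns \<longrightarrow> length us = length ms \<longrightarrow>
           (\<forall>k < length ns. \<forall>s \<in> T. (xs ! k) s \<in> carrier_vec (ns ! k)) \<longrightarrow>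
           (\<forall>k < length ms. \<forall>s \<in> T. (us ! k) s \<in> carrier_vec (ms ! k)) \<longrightarrow>
           (\<forall>t \<in> T. M xs us t \<longleftrightarrow>
              structured_equations T n1 n3 H e E J R B
                (\<lambda>s. stack (map (\<lambda>k. (xs ! k) s) p1))
                (\<lambda>s. stack (map (\<lambda>k. (xs ! k) s) p2))
                (\<lambda>s. stack (map (\<lambda>k. (xs ! k) s) p3))
                (\<lambda>s. stack (map (\<lambda>x. x s) us)) t)))"


subsection \<open>Modified nodal analysis\<close>

text \<open>
  The nodes are \<open>0, \<dots>, n - 1\<close> with node \<open>n - 1\<close> grounded (its row is deleted); branch \<open>j\<close> is
  directed from \<open>src j\<close> to \<open>tgt j\<close>.
\<close>

definition reduced_incidence_mat :: "nat \<Rightarrow> nat \<Rightarrow> real mat \<Rightarrow> bool" where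
  "reduced_incidence_mat n b A \<longleftrightarrow>
     (\<exists>src tgt :: nat \<Rightarrow> nat. (\<forall>j<b. src j < n \<and> tgt j < n) \<and>
        A = mat (n - 1) b (\<lambda>(i, j). of_bool (i = src j) - of_bool (i = tgt j)))"

definition mna_equations ::
    "real set \<Rightarrow> real mat \<Rightarrow> real mat \<Rightarrow> real mat \<Rightarrow> real mat \<Rightarrow> real mat \<Rightarrow>
     real mat \<Rightarrow> real mat \<Rightarrow> real mat \<Rightarrow>
     (real \<Rightarrow> real vec) \<Rightarrow> (real \<Rightarrow> real vec) \<Rightarrow> (real \<Rightarrow> real vec) \<Rightarrow>
     (real \<Rightarrow> real vec) \<Rightarrow> (real \<Rightarrow> real vec) \<Rightarrow> real \<Rightarrow> bool"
  where
  "mna_equations T AC AR AL AV AI C G L \<phi> jL jV jI v t \<longleftrightarrow>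
     (\<exists>d\<phi> djL. has_time_derivative \<phi> d\<phi> t T \<and> has_time_derivative jL djL t T \<and>
        (AC * C * AC\<^sup>T) *\<^sub>v d\<phi> + (AR * G * AR\<^sup>T) *\<^sub>v \<phi> t
          + AL *\<^sub>v jL t + AV *\<^sub>v jV t + AI *\<^sub>v jI t = 0\<^sub>v (dim_row AC) \<and>
        L *\<^sub>v djL - AL\<^sup>T *\<^sub>v \<phi> t = 0\<^sub>v (dim_row L) \<and>
        AV\<^sup>T *\<^sub>v \<phi> t - v t = 0\<^sub>v (dim_col AV))"

end

theory Submission
  imports Defs
begin

text \<open>
  Take \<open>z\<^sub>1\<close> absent, \<open>z\<^sub>2 = (\<phi>, j\<^sub>L)\<close> and \<open>z\<^sub>3 = j\<^sub>V\<close>, with \<open>E = diag(A\<^sub>C C A\<^sub>C\<^sup>T, L)\<close>, the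
  quadratic energy \<open>H = z\<^sub>2\<^sup>T E z\<^sub>2 / 2\<close> and \<open>e = z\<^sub>2\<close>. As \<open>E\<close> is symmetric, \<open>E\<^sup>T e\<close> is the gradient
  of \<open>H\<close> even when \<open>E\<close> is singular. The incidence matrices \<open>A\<^sub>L\<close> and \<open>A\<^sub>V\<close> enter the skew-symmetric
  \<open>J\<close>, the resistive term \<open>A\<^sub>R G A\<^sub>R\<^sup>T\<close> is the only nonzero block of \<open>R\<close>.
\<close>

section \<open>Concatenated vectors and matrices stacked by rows\<close>

lemma append_vec_assoc: "(u @\<^sub>v v) @\<^sub>v w = u @\<^sub>v (v @\<^sub>v w)"
  by (rule eq_vecI) auto

lemma append_vec_vNil_right [simp]: "v @\<^sub>v vNil = v"
  by (rule eq_vecI) auto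

text \<open>Each column of the stacked matrix is a concatenation of two columns, so its scalar
  product with \<open>x @\<^sub>v y\<close> splits. This evaluates the current balance, where the
  transpose of \<open>Q\<close> acts on \<open>j @\<^sub>v jV\<close>.\<close>

lemma transpose_append_rows_mult_vec:
  fixes A B :: "'a :: comm_semiring_0 mat"
  assumes "A \<in> carrier_mat n1 m" "B \<in> carrier_mat n2 m"
    and "x \<in> carrier_vec n1" "y \<in> carrier_vec n2"
  shows "(A @\<^sub>r B)\<^sup>T *\<^sub>v (x @\<^sub>v y) = A\<^sup>T *\<^sub>v x + B\<^sup>T *\<^sub>v y"
proof (rule eq_vecI)
  fix i assume "i < dim_vec (A\<^sup>T *\<^sub>v x + B\<^sup>T *\<^sub>v y)"
  then have i: "i < m" using assms by auto
  have "col (A @\<^sub>r B) i = col A i @\<^sub>v col B i"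
    unfolding append_rows_def using assms i by (intro eq_vecI) auto
  with assms i show "((A @\<^sub>r B)\<^sup>T *\<^sub>v (x @\<^sub>v y)) $ i = (A\<^sup>T *\<^sub>v x + B\<^sup>T *\<^sub>v y) $ i"
    using scalar_prod_append[of "col A i" n1 "col B i" n2 x y]
    by (auto simp: append_rows_def)
qed (use assms in \<open>auto simp: append_rows_def\<close>)

section \<open>Constructions of positive semidefinite matrices\<close>

lemma positive_definite_imp_semidefinite:
  assumes "positive_definite n A"
  shows "positive_semidefinite n A"
  unfolding positive_semidefinite_def
proof (intro conjI ballI)
  fix x :: "real vec" assume x: "x \<in> carrier_vec n"
  show "x \<bullet> (A *\<^sub>v x) \<ge> 0"
  proof (cases "x = 0\<^sub>v n")
    case True
    with assms show ?thesis by (auto simp: positive_definite_def)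
  next
    case False
    with assms x show ?thesis by (auto simp: positive_definite_def intro: less_imp_le)
  qed
qed (use assms in \<open>auto simp: positive_definite_def\<close>)

lemma transpose_congruence:
  fixes A G :: "'a :: comm_semiring_0 mat"
  assumes A: "A \<in> carrier_mat m n" and G: "G \<in> carrier_mat n n" and "G\<^sup>T = G"
  shows "(A * G * A\<^sup>T)\<^sup>T = A * G * A\<^sup>T"
proof -
  have "(A * G * A\<^sup>T)\<^sup>T = A * (G\<^sup>T * A\<^sup>T)"
    using A G transpose_mult[of "A * G" m n "A\<^sup>T" m] transpose_mult[OF A G] by simp
  also have "\<dots> = A * G * A\<^sup>T"
    unfolding assms using A G by (intro assoc_mult_mat[symmetric]) auto
  finally show ?thesis .
qed

text \<open>Moving \<open>A\<close> across the scalar product turns the quadratic form at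
  \<open>x\<close> into that of \<open>G\<close> at \<open>A\<^sup>T *\<^sub>v x\<close>. With
  \<open>AR\<close> and the conductances this gives the dissipation block \<open>P\<close>.\<close>

lemma positive_semidefinite_congruence:
  assumes A: "A \<in> carrier_mat m n" and G: "positive_semidefinite n G"
  shows "positive_semidefinite m (A * G * A\<^sup>T)"
  unfolding positive_semidefinite_def
proof (intro conjI ballI)
  have Gc: "G \<in> carrier_mat n n" "G\<^sup>T = G"
    using G by (auto simp: positive_semidefinite_def)
  show "A * G * A\<^sup>T \<in> carrier_mat m m" using A Gc by auto
  show "(A * G * A\<^sup>T)\<^sup>T = A * G * A\<^sup>T" by (rule transpose_congruence[OF A Gc])
  fix x :: "real vec" assume x: "x \<in> carrier_vec m"
  let ?y = "A\<^sup>T *\<^sub>v x"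
  have y: "?y \<in> carrier_vec n" using A x by auto
  have Gy: "G *\<^sub>v ?y \<in> carrier_vec n" using Gc y by auto
  have "(A * G * A\<^sup>T) *\<^sub>v x = (A * G) *\<^sub>v ?y"
    using A Gc x by (intro assoc_mult_mat_vec) auto
  also have "\<dots> = A *\<^sub>v (G *\<^sub>v ?y)"
    using A Gc y by (intro assoc_mult_mat_vec) auto
  finally have "x \<bullet> ((A * G * A\<^sup>T) *\<^sub>v x) = ?y \<bullet> (G *\<^sub>v ?y)"
    using transpose_vec_mult_scalar[OF A Gy x] x A Gy y
    by (metis comm_scalar_prod mult_mat_vec_carrier)
  then show "x \<bullet> ((A * G * A\<^sup>T) *\<^sub>v x) \<ge> 0"
    using G y by (auto simp: positive_semidefinite_def)
qed

text \<open>The quadratic form of the padded matrix sees only the first \<open>n\<close> entries of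
  its argument. This passes from \<open>P\<close> to \<open>R\<close>.\<close>

lemma positive_semidefinite_block_zero:
  assumes P: "positive_semidefinite n P"
  shows "positive_semidefinite (n + m) (four_block_mat P (0\<^sub>m n m) (0\<^sub>m m n) (0\<^sub>m m m))"
  unfolding positive_semidefinite_def
proof (intro conjI ballI)
  have Pc: "P \<in> carrier_mat n n" "P\<^sup>T = P"
    using P by (auto simp: positive_semidefinite_def)
  let ?R = "four_block_mat P (0\<^sub>m n m) (0\<^sub>m m n) (0\<^sub>m m m)"
  show "?R \<in> carrier_mat (n + m) (n + m)" using Pc by auto
  show "?R\<^sup>T = ?R"
    using Pc by (subst transpose_four_block_mat) auto
  fix x :: "real vec" assume x: "x \<in> carrier_vec (n + m)"
  let ?a = "vec_first x n" and ?b = "vec_last x m"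
  have "?R *\<^sub>v (?a @\<^sub>v ?b) = P *\<^sub>v ?a @\<^sub>v 0\<^sub>v m"
    using Pc by (subst four_block_mat_mult_vec) auto
  then have "x \<bullet> (?R *\<^sub>v x) = (?a @\<^sub>v ?b) \<bullet> (P *\<^sub>v ?a @\<^sub>v 0\<^sub>v m)"
    using x by simp
  also have "\<dots> = ?a \<bullet> (P *\<^sub>v ?a)"
    using Pc by (subst scalar_prod_append[of _ n _ m]) auto
  finally show "x \<bullet> (?R *\<^sub>v x) \<ge> 0"
    using P by (auto simp: positive_semidefinite_def)
qed

section \<open>Gradients and continuity for quadratic forms\<close>

lemma quadratic_form_shift:
  fixes A :: "real mat"
  assumes A: "A \<in> carrier_mat n n" and sym: "A\<^sup>T = A"
    and x: "x \<in> carrier_vec n" and i: "i < n"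
  shows "(x + s \<cdot>\<^sub>v unit_vec n i) \<bullet> (A *\<^sub>v (x + s \<cdot>\<^sub>v unit_vec n i)) =
    x \<bullet> (A *\<^sub>v x) + 2 * s * (A *\<^sub>v x) $ i + s\<^sup>2 * A $$ (i, i)"
proof -
  let ?e = "unit_vec n i :: real vec"
  have Ae: "A *\<^sub>v ?e \<in> carrier_vec n" and Ax: "A *\<^sub>v x \<in> carrier_vec n" using A x by auto
  have "A *\<^sub>v (x + s \<cdot>\<^sub>v ?e) = A *\<^sub>v x + s \<cdot>\<^sub>v (A *\<^sub>v ?e)"
    using A x by (simp add: mult_add_distrib_mat_vec mult_mat_vec)
  \<comment> \<open>Symmetry enters here: it makes the two mixed terms equal, hence the factor 2 in
    the linear coefficient.\<close>
  moreover have "x \<bullet> (A *\<^sub>v ?e) = (A *\<^sub>v x) $ i"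
    using transpose_vec_mult_scalar[OF A, of ?e x] x i Ax sym by simp
  moreover have "?e \<bullet> (A *\<^sub>v x) = (A *\<^sub>v x) $ i" using Ax i by simp
  moreover have "?e \<bullet> (A *\<^sub>v ?e) = A $$ (i, i)" using Ae A i by simp
  moreover have "(s \<cdot>\<^sub>v ?e) \<bullet> (A *\<^sub>v x) = s * (?e \<bullet> (A *\<^sub>v x))"
    using Ax by (intro smult_scalar_prod_distrib[of _ n]) auto
  moreover have "(s \<cdot>\<^sub>v ?e) \<bullet> (s \<cdot>\<^sub>v (A *\<^sub>v ?e)) = s * (s * (?e \<bullet> (A *\<^sub>v ?e)))"
    using Ae smult_scalar_prod_distrib[of ?e n "s \<cdot>\<^sub>v (A *\<^sub>v ?e)" s]
      scalar_prod_smult_distrib[of ?e n "A *\<^sub>v ?e" s] by simp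
  ultimately show ?thesis
    using x Ae Ax
    by (simp add: add_scalar_prod_distrib[of _ n] scalar_prod_add_distrib[of _ n]
        power2_eq_square algebra_simps)
qed

text \<open>Along a coordinate line the form is a quadratic polynomial in \<open>s\<close>, whose
  linear coefficient is the derivative at 0. Fixing \<open>f\<close> only on
  \<open>carrier_vec n\<close> lets the lemma apply to \<open>joint 0 n H\<close>, which
  \<open>joint_0\<close> evaluates only there.\<close>

lemma quadratic_form_has_derivative:
  fixes A :: "real mat"
  assumes "A \<in> carrier_mat n n" "A\<^sup>T = A" "x \<in> carrier_vec n" "i < n"
    and f: "\<And>y. y \<in> carrier_vec n \<Longrightarrow> f y = (y \<bullet> (A *\<^sub>v y)) / 2"
  shows "((\<lambda>s. f (x + s \<cdot>\<^sub>v unit_vec n i)) has_real_derivative (A *\<^sub>v x) $ i) (at 0)"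
proof -
  have "(\<lambda>s. f (x + s \<cdot>\<^sub>v unit_vec n i)) =
      (\<lambda>s. (x \<bullet> (A *\<^sub>v x) + 2 * s * (A *\<^sub>v x) $ i + s\<^sup>2 * A $$ (i, i)) / 2)"
    using assms by (simp add: f quadratic_form_shift)
  then show ?thesis by (auto intro!: derivative_eq_intros)
qed

lemma gradient_quadratic_form:
  fixes A :: "real mat"
  assumes "A \<in> carrier_mat n n" "A\<^sup>T = A" "x \<in> carrier_vec n"
    and "\<And>y. y \<in> carrier_vec n \<Longrightarrow> f y = (y \<bullet> (A *\<^sub>v y)) / 2"
  shows "gradient n f x = A *\<^sub>v x"
  unfolding gradient_def
  using assms DERIV_imp_deriv[OF quadratic_form_has_derivative[OF assms(1-3) _ assms(4)]]
  by (intro eq_vecI) auto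

lemma continuous_Rn_component:
  assumes "i < n" and "\<And>x. x \<in> carrier_vec n \<Longrightarrow> f x = x $ i"
  shows "continuous_Rn n f"
proof -
  have "continuous_map (Euclidean_space n) euclideanreal (\<lambda>x. x i)"
    unfolding Euclidean_space_def
    by (intro continuous_map_from_subtopology continuous_map_product_projection) auto
  moreover have "(\<lambda>x. f (vec n x)) = (\<lambda>x. x i)" using assms by auto
  ultimately show ?thesis by (simp add: continuous_Rn_def)
qed

text \<open>An entry of the product is a finite linear combination of coordinate projections. It
  serves for the continuity of the partial derivatives of a quadratic form.\<close>

lemma continuous_Rn_mult_mat_vec:
  assumes A: "A \<in> carrier_mat m n" and i: "i < m"
    and f: "\<And>x. x \<in> carrier_vec n \<Longrightarrow> f x = (A *\<^sub>v x) $ i"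
  shows "continuous_Rn n f"
proof -
  have "continuous_map (Euclidean_space n) euclideanreal (\<lambda>x. \<Sum>j<n. A $$ (i, j) * x j)"
    unfolding Euclidean_space_def
    by (intro continuous_map_sum continuous_map_real_mult continuous_map_from_subtopology
        continuous_map_product_projection) auto
  moreover have "(\<lambda>x. f (vec n x)) = (\<lambda>x. \<Sum>j<n. A $$ (i, j) * x j)"
    using A i by (auto simp: f scalar_prod_def lessThan_atLeast0 intro!: sum.cong)
  ultimately show ?thesis by (simp add: continuous_Rn_def)
qed

lemma C1_Rn_quadratic_form:
  fixes A :: "real mat"
  assumes "A \<in> carrier_mat n n" "A\<^sup>T = A"
    and "\<And>y. y \<in> carrier_vec n \<Longrightarrow> f y = (y \<bullet> (A *\<^sub>v y)) / 2"
  shows "C1_Rn n f"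
  unfolding C1_Rn_def
proof (intro allI impI conjI ballI)
  fix i assume i: "i < n"
  show "continuous_Rn n (\<lambda>x. gradient n f x $ i)"
    using assms i gradient_quadratic_form[OF assms(1,2) _ assms(3)]
    by (intro continuous_Rn_mult_mat_vec[of A n n i]) auto
  fix x :: "real vec" assume "x \<in> carrier_vec n"
  from quadratic_form_has_derivative[OF assms(1,2) this i assms(3)]
  show "(\<lambda>s. f (x + s \<cdot>\<^sub>v unit_vec n i)) differentiable at 0"
    by (auto simp: real_differentiable_def)
qed

section \<open>Absent first component and derivatives of stacked trajectories\<close>

lemma joint_0:
  assumes "w \<in> carrier_vec n"
  shows "joint 0 n f w = f vNil w"
proof -
  have "vec_first w 0 = 0\<^sub>v 0" "vec_last w n = w"
    using assms by (auto simp: vec_last_def)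
  then show ?thesis by (simp add: joint_def)
qed

lemma has_time_derivative_append:
  assumes x: "\<forall>s\<in>T. x s \<in> carrier_vec n" and y: "\<forall>s\<in>T. y s \<in> carrier_vec m"
    and a: "a \<in> carrier_vec n" and b: "b \<in> carrier_vec m" and t: "t \<in> T"
  shows "has_time_derivative (\<lambda>s. x s @\<^sub>v y s) (a @\<^sub>v b) t T \<longleftrightarrow>
    has_time_derivative x a t T \<and> has_time_derivative y b t T"
proof -
  \<comment> \<open>The dimensions of \<open>x s\<close> and \<open>y s\<close> are known only for
    \<open>s\<close> in \<open>T\<close>. This suffices, as a derivative within \<open>T\<close> at
    a point of \<open>T\<close> depends only on the values on \<open>T\<close>.\<close>
  have cong: "(f has_real_derivative d) (at t within T) \<longleftrightarrow>
      (g has_real_derivative d) (at t within T)" if "\<And>s. s \<in> T \<Longrightarrow> f s = g s" for f g :: "real \<Rightarrow> real" and d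
    using that t by (intro has_field_derivative_cong_eventually)
      (auto simp: eventually_at_filter)
  have 1: "((\<lambda>s. (x s @\<^sub>v y s) $ i) has_real_derivative d) (at t within T) \<longleftrightarrow>
      ((\<lambda>s. x s $ i) has_real_derivative d) (at t within T)" if "i < n" for i d
  proof (rule cong)
    fix s assume "s \<in> T"
    with x y have "x s \<in> carrier_vec n" "y s \<in> carrier_vec m" by auto
    with that show "(x s @\<^sub>v y s) $ i = x s $ i" by auto
  qed
  have 2: "((\<lambda>s. (x s @\<^sub>v y s) $ (n + i)) has_real_derivative d) (at t within T) \<longleftrightarrow>
      ((\<lambda>s. y s $ i) has_real_derivative d) (at t within T)" if "i < m" for i d
  proof (rule cong)
    fix s assume "s \<in> T"
    with x y have "x s \<in> carrier_vec n" "y s \<in> carrier_vec m" by auto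
    with that show "(x s @\<^sub>v y s) $ (n + i) = y s $ i" by auto
  qed
  have split: "(\<forall>i < n + m. P i) \<longleftrightarrow> (\<forall>i<n. P i) \<and> (\<forall>i<m. P (n + i))" for P
    by (metis add_diff_inverse_nat add_less_cancel_left trans_less_add1)
  have "x t \<in> carrier_vec n" "y t \<in> carrier_vec m" using x y t by auto
  then show ?thesis
    using a b by (auto simp: has_time_derivative_def split 1 2)
qed

text \<open>A derivative of the stack has dimension \<open>n + m\<close> and can therefore be cut
  into two pieces. This matches the single \<open>dz2\<close> of the structured system with the pair
  \<open>d\<phi>\<close>, \<open>djL\<close> of the circuit model.\<close>

lemma ex_has_time_derivative_append:
  assumes x: "\<forall>s\<in>T. x s \<in> carrier_vec n" and y: "\<forall>s\<in>T. y s \<in> carrier_vec m"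
    and t: "t \<in> T"
  shows "(\<exists>d. has_time_derivative (\<lambda>s. x s @\<^sub>v y s) d t T \<and> P d) \<longleftrightarrow>
    (\<exists>a b. has_time_derivative x a t T \<and> has_time_derivative y b t T \<and> P (a @\<^sub>v b))"
proof -
  have c: "x t \<in> carrier_vec n" "y t \<in> carrier_vec m" using x y t by auto
  have "d = vec_first d n @\<^sub>v vec_last d m"
    if "has_time_derivative (\<lambda>s. x s @\<^sub>v y s) d t T" for d
  proof -
    have "d \<in> carrier_vec (n + m)"
      using that c by (auto simp: has_time_derivative_def intro: carrier_vecI)
    then show ?thesis by simp
  qed
  moreover have "has_time_derivative x a t T \<Longrightarrow> a \<in> carrier_vec n"
    "has_time_derivative y b t T \<Longrightarrow> b \<in> carrier_vec m" for a b
    using c by (auto simp: has_time_derivative_def intro!: carrier_vecI)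
  ultimately show ?thesis
    using has_time_derivative_append[OF x y _ _ t]
    by (metis vec_first_carrier vec_last_carrier)
qed

text \<open>There are no entries to differentiate, so only the dimension condition remains. It
  removes the quantifier over \<open>dz1\<close> when the first component is absent.\<close>

lemma has_time_derivative_vNil:
  "has_time_derivative (\<lambda>s. vNil) d t T \<longleftrightarrow> d = vNil"
  by (auto simp: has_time_derivative_def intro!: eq_vecI)

lemma gradient_0: "gradient 0 f x = vNil"
  by (auto simp: gradient_def)

section \<open>The circuit equations as a structured system\<close>

theorem theorem15:
  fixes n bC bR bL bV bI :: nat
    and AC AR AL AV AI C G L :: "real mat"
    and t0 tf :: real
  assumes "t0 < tf" and "n \<ge> 1"
    and "reduced_incidence_mat n bC AC"
    and "reduced_incidence_mat n bR AR"
    and "reduced_incidence_mat n bL AL"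
    and "reduced_incidence_mat n bV AV"
    and "reduced_incidence_mat n bI AI"
    and "positive_definite bC C"
    and "positive_definite bR G"
    and "positive_definite bL L"
  shows "fits_into_structure {t0..tf} [n - 1, bL, bV] [bI, bV]
           (\<lambda>xs us. mna_equations {t0..tf} AC AR AL AV AI C G L
                      (xs ! 0) (xs ! 1) (xs ! 2) (us ! 0) (us ! 1))"
proof -
  define T where "T = {t0..tf}"
  define N where "N = n - 1"
  have AC: "AC \<in> carrier_mat N bC" and AR: "AR \<in> carrier_mat N bR"
    and AL: "AL \<in> carrier_mat N bL" and AV: "AV \<in> carrier_mat N bV"
    and AI: "AI \<in> carrier_mat N bI"
    using assms by (auto simp: reduced_incidence_mat_def N_def)
  have C: "C \<in> carrier_mat bC bC" "C\<^sup>T = C" and L: "L \<in> carrier_mat bL bL" "L\<^sup>T = L"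
    using assms by (auto simp: positive_definite_def)
  define K where "K = AC * C * AC\<^sup>T"
  define P where "P = AR * G * AR\<^sup>T"
  \<comment> \<open>Blocks are cut after \<open>\<phi>\<close>, with \<open>(j\<^sub>L, j\<^sub>V)\<close> together, so that \<open>J\<close> has only two blocks \<open>Q\<close> and \<open>- Q\<^sup>T\<close>.\<close>
  define Q where "Q = AL\<^sup>T @\<^sub>r AV\<^sup>T"
  define E where "E = four_block_mat K (0\<^sub>m N bL) (0\<^sub>m bL N) L"
  \<comment> \<open>The signs come from solving for the derivative terms: the current balance moves
    \<open>AL\<close> and \<open>AV\<close> to the right with a minus, while the other two rows have
    \<open>AL\<^sup>T\<close> and \<open>AV\<^sup>T\<close> there with a plus.\<close>
  define J where "J = four_block_mat (0\<^sub>m N N) (- Q\<^sup>T) Q (0\<^sub>m (bL + bV) (bL + bV))"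
  define R where "R = four_block_mat P (0\<^sub>m N (bL + bV)) (0\<^sub>m (bL + bV) N) (0\<^sub>m (bL + bV) (bL + bV))"
  \<comment> \<open>The columns are split as source currents, then source voltages. The currents
    enter only the node equations, the voltages only the last \<open>bV\<close> rows.\<close>
  define B where "B = four_block_mat (- AI) (0\<^sub>m N bV) (0\<^sub>m (bL + bV) bI) (0\<^sub>m bL bV @\<^sub>r - 1\<^sub>m bV)"
  \<comment> \<open>At \<open>z2\<close> = (\<open>\<phi>\<close>, \<open>jL\<close>) this is the
    energy stored in the capacitances plus that in the inductances.\<close>
  define H where "H = (\<lambda>(z1 :: real vec) (z2 :: real vec). (z2 \<bullet> (E *\<^sub>v z2)) / 2)"
  have K: "K \<in> carrier_mat N N" "K\<^sup>T = K"
    using AC C transpose_congruence[OF AC C] by (auto simp: K_def)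
  have psdP: "positive_semidefinite N P"
    unfolding P_def using assms
    by (intro positive_semidefinite_congruence[OF AR] positive_definite_imp_semidefinite)
  then have P: "P \<in> carrier_mat N N" by (simp add: positive_semidefinite_def)
  have Q: "Q \<in> carrier_mat (bL + bV) N" using AL AV by (auto simp: Q_def)
  have E: "E \<in> carrier_mat (N + bL) (N + bL)" using K L by (auto simp: E_def)
  have symE: "E\<^sup>T = E"
    unfolding E_def using K L by (subst transpose_four_block_mat) auto
  have J: "J \<in> carrier_mat (N + (bL + bV)) (N + (bL + bV))" using Q by (auto simp: J_def)
  have skew: "J = - J\<^sup>T"
    unfolding J_def using Q by (intro eq_matI) auto
  have R: "positive_semidefinite (N + (bL + bV)) R"
    unfolding R_def by (rule positive_semidefinite_block_zero[OF psdP])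
  have D: "0\<^sub>m bL bV @\<^sub>r - 1\<^sub>m bV \<in> carrier_mat (bL + bV) bV" by auto
  then have B: "B \<in> carrier_mat (N + (bL + bV)) (bI + bV)"
    using AI by (auto simp: B_def)
  have JR: "J - R = four_block_mat (- P) (- Q\<^sup>T) Q (0\<^sub>m (bL + bV) (bL + bV))"
    unfolding J_def R_def using P Q by (intro eq_matI) auto

  \<comment> \<open>Pure linear algebra at one instant: arbitrary vectors \<open>df\<close> and
    \<open>dj\<close> stand for the derivatives, so no calculus is involved.\<close>
  have equations: "E *\<^sub>v (df @\<^sub>v dj) @\<^sub>v 0\<^sub>v bV =
        (J - R) *\<^sub>v ((f @\<^sub>v j) @\<^sub>v jV) + B *\<^sub>v (i @\<^sub>v v) \<longleftrightarrow>
      K *\<^sub>v df + P *\<^sub>v f + AL *\<^sub>v j + AV *\<^sub>v jV + AI *\<^sub>v i = 0\<^sub>v N \<and>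
      L *\<^sub>v dj - AL\<^sup>T *\<^sub>v f = 0\<^sub>v bL \<and> AV\<^sup>T *\<^sub>v f - v = 0\<^sub>v bV"
    if df: "df \<in> carrier_vec N" and dj: "dj \<in> carrier_vec bL" and f: "f \<in> carrier_vec N"
      and j: "j \<in> carrier_vec bL" and jV: "jV \<in> carrier_vec bV"
      and i: "i \<in> carrier_vec bI" and v: "v \<in> carrier_vec bV" for df dj f j jV i v
  proof -
    have "E *\<^sub>v (df @\<^sub>v dj) = K *\<^sub>v df @\<^sub>v L *\<^sub>v dj"
      unfolding E_def using K L df dj by (subst four_block_mat_mult_vec) auto
    \<comment> \<open>The stack is grouped as (\<open>\<phi>\<close>, \<open>jL\<close>) followed by
      \<open>jV\<close>; reassociating moves the cut to just after \<open>\<phi>\<close>, where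
      \<open>J\<close>, \<open>R\<close> and \<open>B\<close> are cut.\<close>
    then have lhs: "E *\<^sub>v (df @\<^sub>v dj) @\<^sub>v 0\<^sub>v bV = K *\<^sub>v df @\<^sub>v (L *\<^sub>v dj @\<^sub>v 0\<^sub>v bV)"
      by (simp add: append_vec_assoc)
    have Qf: "Q *\<^sub>v f = AL\<^sup>T *\<^sub>v f @\<^sub>v AV\<^sup>T *\<^sub>v f"
      unfolding Q_def using AL AV f by (intro mat_mult_append) auto
    have Qj: "Q\<^sup>T *\<^sub>v (j @\<^sub>v jV) = AL *\<^sub>v j + AV *\<^sub>v jV"
      unfolding Q_def
      using transpose_append_rows_mult_vec[of "AL\<^sup>T" bL N "AV\<^sup>T" bV j jV] AL AV j jV by simp
    have jjV: "j @\<^sub>v jV \<in> carrier_vec (bL + bV)" using j jV by simp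
    have "(J - R) *\<^sub>v (f @\<^sub>v (j @\<^sub>v jV)) =
        (- (P *\<^sub>v f) - (AL *\<^sub>v j + AV *\<^sub>v jV)) @\<^sub>v (AL\<^sup>T *\<^sub>v f @\<^sub>v AV\<^sup>T *\<^sub>v f)"
      unfolding JR
      apply (subst four_block_mat_mult_vec[of _ N N _ "bL + bV" _ "bL + bV"])
      using P Q f jjV AL AV j jV
      by (auto simp: Qf[symmetric] Qj[symmetric])
    moreover have "(0\<^sub>m bL bV @\<^sub>r - 1\<^sub>m bV) *\<^sub>v v = 0\<^sub>v bL @\<^sub>v - v"
      using v by (subst mat_mult_append[of _ bL bV _ bV]) auto
    then have "B *\<^sub>v (i @\<^sub>v v) = - (AI *\<^sub>v i) @\<^sub>v (0\<^sub>v bL @\<^sub>v - v)"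
      unfolding B_def
      apply (subst four_block_mat_mult_vec[of _ N bI _ bV _ "bL + bV"])
      using AI i v D by auto
    ultimately have rhs: "(J - R) *\<^sub>v ((f @\<^sub>v j) @\<^sub>v jV) + B *\<^sub>v (i @\<^sub>v v) =
        (- (P *\<^sub>v f) - (AL *\<^sub>v j + AV *\<^sub>v jV) - AI *\<^sub>v i) @\<^sub>v
        (AL\<^sup>T *\<^sub>v f @\<^sub>v (AV\<^sup>T *\<^sub>v f - v))"
      using P AL AV AI f j jV i v by (intro eq_vecI) (auto simp: append_vec_assoc)
    \<comment> \<open>Both sides are now stacks of three blocks. Each block equation becomes a
      circuit equation after moving all terms to one side.\<close>
    have "K *\<^sub>v df = - (P *\<^sub>v f) - (AL *\<^sub>v j + AV *\<^sub>v jV) - AI *\<^sub>v i \<longleftrightarrow>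
        K *\<^sub>v df + P *\<^sub>v f + AL *\<^sub>v j + AV *\<^sub>v jV + AI *\<^sub>v i = 0\<^sub>v N"
      using K P AL AV AI by (auto simp: vec_eq_iff algebra_simps)
    moreover have "L *\<^sub>v dj = AL\<^sup>T *\<^sub>v f \<longleftrightarrow> L *\<^sub>v dj - AL\<^sup>T *\<^sub>v f = 0\<^sub>v bL"
      using L AL by (auto simp: vec_eq_iff)
    moreover have "0\<^sub>v bV = AV\<^sup>T *\<^sub>v f - v \<longleftrightarrow> AV\<^sup>T *\<^sub>v f - v = 0\<^sub>v bV" by auto
    moreover have row1: "K *\<^sub>v df \<in> carrier_vec N"
      "- (P *\<^sub>v f) - (AL *\<^sub>v j + AV *\<^sub>v jV) - AI *\<^sub>v i \<in> carrier_vec N"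
      and row2: "L *\<^sub>v dj \<in> carrier_vec bL" "AL\<^sup>T *\<^sub>v f \<in> carrier_vec bL"
      using K P AL AV AI L by (auto intro!: carrier_vecI)
    ultimately show ?thesis
      unfolding lhs rhs append_vec_eq[OF row1] append_vec_eq[OF row2] by simp
  qed

  have structured: "mna_equations T AC AR AL AV AI C G L (xs ! 0) (xs ! 1) (xs ! 2) (us ! 0) (us ! 1) t \<longleftrightarrow>
      structured_equations T 0 bV H (\<lambda>z1 z2. z2) E J R B
        (\<lambda>s. stack (map (\<lambda>k. (xs ! k) s) []))
        (\<lambda>s. stack (map (\<lambda>k. (xs ! k) s) [0, 1]))
        (\<lambda>s. stack (map (\<lambda>k. (xs ! k) s) [2]))
        (\<lambda>s. stack (map (\<lambda>x. x s) us)) t"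
    if len: "length us = 2"
      and xs: "\<forall>k < 3. \<forall>s \<in> T. (xs ! k) s \<in> carrier_vec ([N, bL, bV] ! k)"
      and us: "\<forall>k < 2. \<forall>s \<in> T. (us ! k) s \<in> carrier_vec ([bI, bV] ! k)"
      and t: "t \<in> T" for xs us t
  proof -
    obtain i v where iv: "us = [i, v]"
      using len by (auto simp: numeral_2_eq_2 length_Suc_conv)
    define f j jV where "f = xs ! 0" and "j = xs ! 1" and "jV = xs ! 2"
    have f: "\<forall>s\<in>T. f s \<in> carrier_vec N" and j: "\<forall>s\<in>T. j s \<in> carrier_vec bL"
      and jV: "jV t \<in> carrier_vec bV"
      using xs[rule_format, of 0] xs[rule_format, of 1] xs[rule_format, of 2] t
      by (auto simp: f_def j_def jV_def)
    have i: "i t \<in> carrier_vec bI" and v: "v t \<in> carrier_vec bV"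
      using us[rule_format, of 0 t] us[rule_format, of 1 t] t by (auto simp: iv)
    have carr: "f t \<in> carrier_vec N" "j t \<in> carrier_vec bL" using f j t by auto
    \<comment> \<open>\<open>has_time_derivative\<close> forces the dimension of the trajectory on
      any derivative, so \<open>equations\<close> applies to every candidate under the
      quantifiers.\<close>
    have d: "df \<in> carrier_vec N" if "has_time_derivative f df t T" for df
      using that carr by (auto simp: has_time_derivative_def intro!: carrier_vecI)
    have d': "dj \<in> carrier_vec bL" if "has_time_derivative j dj t T" for dj
      using that carr by (auto simp: has_time_derivative_def intro!: carrier_vecI)
    have "structured_equations T 0 bV H (\<lambda>z1 z2. z2) E J R B
        (\<lambda>s. stack (map (\<lambda>k. (xs ! k) s) []))
        (\<lambda>s. stack (map (\<lambda>k. (xs ! k) s) [0, 1]))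
        (\<lambda>s. stack (map (\<lambda>k. (xs ! k) s) [2]))
        (\<lambda>s. stack (map (\<lambda>x. x s) us)) t \<longleftrightarrow>
      (\<exists>d. has_time_derivative (\<lambda>s. f s @\<^sub>v j s) d t T \<and>
         E *\<^sub>v d @\<^sub>v 0\<^sub>v bV =
         (J - R) *\<^sub>v ((f t @\<^sub>v j t) @\<^sub>v jV t) + B *\<^sub>v (i t @\<^sub>v v t))"
      by (simp add: structured_equations_def stack_def iv has_time_derivative_vNil gradient_0
          flip: f_def j_def jV_def One_nat_def)
    also have "\<dots> \<longleftrightarrow> mna_equations T AC AR AL AV AI C G L f j jV i v t"
      unfolding ex_has_time_derivative_append[OF f j t] mna_equations_def
      using equations[OF d d' carr jV i v] AC L AV by (auto simp: K_def P_def)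
    finally show ?thesis by (simp add: iv f_def j_def jV_def)
  qed

  have H: "joint 0 (N + bL) H y = (y \<bullet> (E *\<^sub>v y)) / 2" if "y \<in> carrier_vec (N + bL)" for y
    using that by (simp add: joint_0 H_def)
  have gradH: "gradient (N + bL) (\<lambda>w. H z1 w) z2 = E *\<^sub>v z2"
    if "z2 \<in> carrier_vec (N + bL)" for z1 z2
    by (rule gradient_quadratic_form[OF E symE that]) (simp add: H_def)
  show ?thesis
    unfolding fits_into_structure_def T_def[symmetric] N_def[symmetric]
    \<comment> \<open>The unknowns are numbered 0 for \<open>\<phi>\<close>, 1 for \<open>jL\<close>
      and 2 for \<open>jV\<close>; these lists distribute them over the three components.\<close>
    apply (rule exI[of _ "[]"], rule exI[of _ "[0, 1]"], rule exI[of _ "[2]"])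
    apply (rule exI[of _ 0], rule exI[of _ "N + bL"], rule exI[of _ bV], rule exI[of _ "bI + bV"])
    apply (rule exI[of _ H], rule exI[of _ "\<lambda>z1 z2. z2"], rule exI[of _ E], rule exI[of _ J],
        rule exI[of _ R], rule exI[of _ B])
    apply (intro conjI)
    using C1_Rn_quadratic_form[OF E symE H] E J skew R B symE gradH structured
    by (auto simp: numeral_3_eq_3 numeral_2_eq_2 add.assoc joint_0 intro!: continuous_Rn_component)
qed

end
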